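(* Let $(X,d)$ be a nonempty compact metric space, let $(\mathcal{U}_{4\epsilon_n}(A_n),q_{n,n+1})$ be a FASO for $X$ with inverse limit $\mathcal{X}$, and let $\mathcal{X}_*=\phi(X)\subseteq\mathcal{X}$, where $\phi:X\to\mathcal{X}$, $\phi(x)=\{X_*^n\}_{n\in\mathbb{N}}$. Then $\mathcal{X}_*$ is a strong deformation retract of $\mathcal{X}$.
   Context: For $\epsilon>0$, a finite subset $A\subseteq X$ is an $\epsilon$-approximation of $X$ if for every $x\in X$ there is $a\in A$ with $d(x,a)<\epsilon$. $\mathcal{B}(x,\epsilon)$ is the open ball. For an $\epsilon$-approximation $A$, $\mathcal{U}_{4\epsilon}(A)$ is the finite set of all nonempty $C\subseteq A$ with $\mathrm{diam}(C)<4\epsilon$, ordered by $C\leq D$ iff $D\subseteq C$, with the topology whose open sets are the lower sets of $\leq$ (the minimal open neighborhood of $C$ is $\{D : C\subseteq D\}$). A FASO (finite approximative sequence with opposite order) for $X$ is an inverse sequence $(\mathcal{U}_{4\epsilon_n}(A_n),q_{n,n+1})_{n\in\mathbb{N}}$, $\mathbb{N}=\{1,2,\dots\}$, where $\epsilon_1>\mathrm{diam}(X)$, each $A_n$ is an $\epsilon_n$-approximation of $X$ ($A_1$ may be a single point), $\gamma_n=\sup\{d(x,A_n) : x\in X\}$, $0<\epsilon_{n+1}<\frac{\epsilon_n-\gamma_n}{2}$ for all $n$, and $q_{n,n+1}:\mathcal{U}_{4\epsilon_{n+1}}(A_{n+1})\to\mathcal{U}_{4\epsilon_n}(A_n)$,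 $q_{n,n+1}(C)=\bigcup_{x\in C}\mathcal{B}(x,\epsilon_n)\cap A_n$ (these maps are well-defined and continuous). For $n<m$, $q_{n,m}=q_{n,n+1}\circ\cdots\circ q_{m-1,m}$. The inverse limit $\mathcal{X}$ is the subspace of $\prod_n\mathcal{U}_{4\epsilon_n}(A_n)$ of sequences $\{C_n\}$ with $q_{n,n+1}(C_{n+1})=C_n$ for all $n$. For $x\in X$ and $n\in\mathbb{N}$: $A_m(x)=\{a\in A_m : d(x,a)=d(x,A_m)\}$ and $X_*^n=\bigcup_{m>n}q_{n,m}(A_m(x))$; the sequence $\{X_*^n\}_{n\in\mathbb{N}}$ is an element of $\mathcal{X}$. A subspace $S\subseteq\mathcal{X}$ is a strong deformation retract if there is a continuous $H:\mathcal{X}\times[0,1]\to\mathcal{X}$ with $H(c,0)=c$ and $H(c,1)\in S$ for all $c\in\mathcal{X}$, and $H(s,t)=s$ for all $s\in S$, $t\in[0,1]$. *)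

theory Defs
  imports "HOL-Analysis.Analysis"
begin

definition eps_approximation :: "'a::metric_space set \<Rightarrow> real \<Rightarrow> 'a set \<Rightarrow> bool"
  where "eps_approximation X \<epsilon> A \<longleftrightarrow>
    \<epsilon> > 0 \<and> finite A \<and> A \<subseteq> X \<and> (\<forall>x\<in>X. \<exists>a\<in>A. dist x a < \<epsilon>)"

text \<open>The points of \<open>\<U>\<^sub>r(A)\<close>, used below with \<open>r = 4\<epsilon>\<close>.\<close>

definition hyp_points :: "real \<Rightarrow> 'a::metric_space set \<Rightarrow> 'a set set"
  where "hyp_points r A = {C. C \<subseteq> A \<and> C \<noteq> {} \<and> diameter C < r}"

text \<open>The order is reverse inclusion, \<open>C \<le> D\<close> iff \<open>D \<subseteq> C\<close>, so a lower set is one that is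
  closed under passing to supersets inside \<open>\<U>\<^sub>r(A)\<close>.\<close>

definition hyp_topology :: "real \<Rightarrow> 'a::metric_space set \<Rightarrow> 'a set topology"
  where "hyp_topology r A = topology (\<lambda>V. V \<subseteq> hyp_points r A \<and>
    (\<forall>D\<in>V. \<forall>C\<in>hyp_points r A. D \<subseteq> C \<longrightarrow> C \<in> V))"

lemma openin_hyp_topology:
  "openin (hyp_topology r A) V \<longleftrightarrow>
    V \<subseteq> hyp_points r A \<and> (\<forall>D\<in>V. \<forall>C\<in>hyp_points r A. D \<subseteq> C \<longrightarrow> C \<in> V)"
proof -
  have "istopology (\<lambda>V. V \<subseteq> hyp_points r A \<and>
    (\<forall>D\<in>V. \<forall>C\<in>hyp_points r A. D \<subseteq> C \<longrightarrow> C \<in> V))"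
    unfolding istopology_def by blast
  then show ?thesis
    by (simp add: hyp_topology_def topology_inverse')
qed

lemma topspace_hyp_topology [simp]: "topspace (hyp_topology r A) = hyp_points r A"
  unfolding topspace_def openin_hyp_topology by blast

text \<open>All sequences below are indexed by \<open>{1..}\<close>; their values at \<open>0\<close> are irrelevant.\<close>

definition covering_defect :: "'a::metric_space set \<Rightarrow> (nat \<Rightarrow> 'a set) \<Rightarrow> nat \<Rightarrow> real"  (* \<gamma>_n *)
  where "covering_defect X A n = (SUP x\<in>X. infdist x (A n))"

definition FASO :: "'a::metric_space set \<Rightarrow> (nat \<Rightarrow> real) \<Rightarrow> (nat \<Rightarrow> 'a set) \<Rightarrow> bool"
  where "FASO X \<epsilon> A \<longleftrightarrow>
    \<epsilon> 1 > diameter X \<and>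
    (\<forall>n\<ge>1. eps_approximation X (\<epsilon> n) (A n)) \<and>
    (\<forall>n\<ge>1. 0 < \<epsilon> (Suc n) \<and> \<epsilon> (Suc n) < (\<epsilon> n - covering_defect X A n) / 2)"

definition bond :: "(nat \<Rightarrow> real) \<Rightarrow> (nat \<Rightarrow> 'a::metric_space set) \<Rightarrow> nat \<Rightarrow> 'a set \<Rightarrow> 'a set"
  where "bond \<epsilon> A n C = (\<Union>x\<in>C. ball x (\<epsilon> n) \<inter> A n)"  (* q_{n,n+1} *)

definition bonds :: "(nat \<Rightarrow> real) \<Rightarrow> (nat \<Rightarrow> 'a::metric_space set) \<Rightarrow> nat \<Rightarrow> nat \<Rightarrow> 'a set \<Rightarrow> 'a set"
  where "bonds \<epsilon> A n m = foldr (\<circ>) (map (bond \<epsilon> A) [n..<m]) id"  (* q_{n,m} *)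

definition inv_limit :: "(nat \<Rightarrow> real) \<Rightarrow> (nat \<Rightarrow> 'a::metric_space set) \<Rightarrow> (nat \<Rightarrow> 'a set) topology"
  where "inv_limit \<epsilon> A = subtopology
    (product_topology (\<lambda>n. hyp_topology (4 * \<epsilon> n) (A n)) {1..})
    {C. \<forall>n\<ge>1. bond \<epsilon> A n (C (Suc n)) = C n}"

definition nearest :: "(nat \<Rightarrow> 'a::metric_space set) \<Rightarrow> nat \<Rightarrow> 'a \<Rightarrow> 'a set"
  where "nearest A m x = {a \<in> A m. dist x a = infdist x (A m)}"

definition star_set :: "(nat \<Rightarrow> real) \<Rightarrow> (nat \<Rightarrow> 'a::metric_space set) \<Rightarrow> 'a \<Rightarrow> nat \<Rightarrow> 'a set"
  where "star_set \<epsilon> A x n = (\<Union>m\<in>{n<..}. bonds \<epsilon> A n m (nearest A m x))"  (* X_*^n *)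

definition phi :: "(nat \<Rightarrow> real) \<Rightarrow> (nat \<Rightarrow> 'a::metric_space set) \<Rightarrow> 'a \<Rightarrow> nat \<Rightarrow> 'a set"
  where "phi \<epsilon> A x = (\<lambda>n\<in>{1..}. star_set \<epsilon> A x n)"

definition strong_deformation_retract_of_space :: "'b set \<Rightarrow> 'b topology \<Rightarrow> bool"
  where "strong_deformation_retract_of_space S T \<longleftrightarrow>
    S \<subseteq> topspace T \<and>
    (\<exists>H. continuous_map (prod_topology T (top_of_set {0..1::real})) T H \<and>
         (\<forall>c\<in>topspace T. H (c, 0) = c \<and> H (c, 1) \<in> S) \<and>
         (\<forall>s\<in>S. \<forall>t\<in>{0..1}. H (s, t) = s))"

end

(*
  Along a thread C of the inverse limit the sets C n are nonempty, have diameters tending to 0 and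
  are linked by steps of length < eps n, so they shrink to a single point x of X, with every point
  of C n within 2 * eps n of x.  The inequality 2 * eps (n+1) + gamma n < eps n then forces every
  nearest-point set A_m(x) into C m, so that the thread phi x is contained termwise in C.  As the
  open sets are closed under enlarging the terms, the homotopy may stay constant for t < 1 and jump
  to phi x at t = 1; continuity there only needs that phi x n does not shrink under small
  perturbations of x, which holds because the increasing union defining it stabilises in A n.
*)
theory Submission
  imports Defs
begin

section \<open>Iterated bonding maps\<close>

lemma bonds_refl [simp]: "bonds \<epsilon> A n n C = C"
  by (simp add: bonds_def)

lemma bonds_Suc_left: "n < m \<Longrightarrow> bonds \<epsilon> A n m C = bond \<epsilon> A n (bonds \<epsilon> A (Suc n) m C)"
  by (simp add: bonds_def upt_conv_Cons)

lemma bonds_Suc_right: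
  assumes "n \<le> m"
  shows "bonds \<epsilon> A n (Suc m) C = bonds \<epsilon> A n m (bond \<epsilon> A m C)"
proof -
  \<comment> \<open>The index list grows at its right end, where \<open>foldr\<close> meets its
    seed. The last bonding map thus becomes a new seed, hence the claim for arbitrary
    \<open>g\<close>.\<close>
  have "foldr (\<circ>) fs g = foldr (\<circ>) fs id \<circ> g" for fs and g :: "'a set \<Rightarrow> 'a set"
    by (induction fs) (auto simp: comp_assoc)
  from this[of "map (bond \<epsilon> A) [n..<m]" "bond \<epsilon> A m"] show ?thesis
    using assms by (simp add: bonds_def)
qed

lemma bond_mono: "C \<subseteq> D \<Longrightarrow> bond \<epsilon> A n C \<subseteq> bond \<epsilon> A n D"
  by (auto simp: bond_def)

lemma bond_UN: "bond \<epsilon> A n (\<Union>i\<in>I. F i) = (\<Union>i\<in>I. bond \<epsilon> A n (F i))"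
  by (auto simp: bond_def)

lemma bonds_mono:
  assumes "n \<le> m" "C \<subseteq> D"
  shows "bonds \<epsilon> A n m C \<subseteq> bonds \<epsilon> A n m D"
  using assms by (induction n rule: inc_induct) (auto simp: bonds_Suc_left intro!: bond_mono)

section \<open>Neighbourhoods and continuity in the inverse limit\<close>

lemma topspace_inv_limit:
  "C \<in> topspace (inv_limit \<epsilon> A) \<longleftrightarrow>
    C \<in> extensional {1..} \<and> (\<forall>n\<ge>1. C n \<in> hyp_points (4 * \<epsilon> n) (A n)) \<and>
    (\<forall>n\<ge>1. bond \<epsilon> A n (C (Suc n)) = C n)"
  by (auto simp: inv_limit_def PiE_iff)

lemma continuous_map_into_inv_limit:
  assumes "\<And>p. p \<in> topspace T \<Longrightarrow> f p \<in> topspace (inv_limit \<epsilon> A)"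
    and "\<And>n. n \<ge> 1 \<Longrightarrow> continuous_map T (hyp_topology (4 * \<epsilon> n) (A n)) (\<lambda>p. f p n)"
  shows "continuous_map T (inv_limit \<epsilon> A) f"
  using assms unfolding topspace_inv_limit
  by (auto simp: inv_limit_def continuous_map_in_subtopology continuous_map_componentwise)

text \<open>For a point \<open>C\<close> this is the minimal open neighbourhood.\<close>

lemma openin_hyp_topology_supersets:
  "openin (hyp_topology r A) {D \<in> hyp_points r A. C \<subseteq> D}"
  by (auto simp: openin_hyp_topology)

text \<open>Preimage of such a neighbourhood under the n-th projection; no other neighbourhoods in
  the inverse limit are used below.\<close>

lemma openin_inv_limit_supersets:
  assumes "n \<ge> 1"
  shows "openin (inv_limit \<epsilon> A) {D \<in> topspace (inv_limit \<epsilon> A). E \<subseteq> D n}"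
proof -
  have "continuous_map (inv_limit \<epsilon> A) (hyp_topology (4 * \<epsilon> n) (A n)) (\<lambda>D. D n)"
    unfolding inv_limit_def
    using assms by (intro continuous_map_from_subtopology continuous_map_product_projection) auto
  then have "openin (inv_limit \<epsilon> A) {D \<in> topspace (inv_limit \<epsilon> A).
      D n \<in> {D \<in> hyp_points (4 * \<epsilon> n) (A n). E \<subseteq> D}}"
    by (rule openin_continuous_map_preimage) (rule openin_hyp_topology_supersets)
  also have "{D \<in> topspace (inv_limit \<epsilon> A). D n \<in> {D \<in> hyp_points (4 * \<epsilon> n) (A n). E \<subseteq> D}}
      = {D \<in> topspace (inv_limit \<epsilon> A). E \<subseteq> D n}"
    using assms by (auto simp: topspace_inv_limit)
  finally show ?thesis .
qed

text \<open>Open sets absorb supersets, so continuity at \<open>x\<close> only requires that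
  \<open>f\<close> does not shrink near \<open>x\<close>. Growth is harmless, which is what lets the
  homotopy jump.\<close>

lemma continuous_map_hyp_topologyI:
  assumes "\<And>x. x \<in> topspace T \<Longrightarrow> f x \<in> hyp_points r A"
    and "\<And>x. x \<in> topspace T \<Longrightarrow> \<exists>U. openin T U \<and> x \<in> U \<and> (\<forall>y\<in>U. f x \<subseteq> f y)"
  shows "continuous_map T (hyp_topology r A) f"
  unfolding continuous_map
proof (intro conjI allI impI)
  show "f ` topspace T \<subseteq> topspace (hyp_topology r A)"
    using assms(1) by auto
  fix V assume V: "openin (hyp_topology r A) V"
  show "openin T {x \<in> topspace T. f x \<in> V}"
  proof (subst openin_subopen, intro ballI)
    fix x assume x: "x \<in> {x \<in> topspace T. f x \<in> V}"
    then obtain U where U: "openin T U" "x \<in> U" "\<forall>y\<in>U. f x \<subseteq> f y"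
      using assms(2) by blast
    have "U \<subseteq> {x \<in> topspace T. f x \<in> V}"
    proof
      fix y assume "y \<in> U"
      then have y: "y \<in> topspace T" "f x \<subseteq> f y"
        using U openin_subset[OF U(1)] by auto
      then have "f y \<in> V"
        using V x assms(1)[OF y(1)] by (auto simp: openin_hyp_topology)
      then show "y \<in> {x \<in> topspace T. f x \<in> V}"
        using y(1) by simp
    qed
    with U show "\<exists>U. openin T U \<and> x \<in> U \<and> U \<subseteq> {x \<in> topspace T. f x \<in> V}"
      by blast
  qed
qed

section \<open>Nearest points and diameters in finite sets\<close>

lemma nearest_nonempty:
  assumes "finite (A m)" "A m \<noteq> {}"
  shows "nearest A m x \<noteq> {}"
proof -
  have "infdist x (A m) = Min (dist x ` A m)"
    using assms by (simp add: infdist_notempty cInf_eq_Min)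
  moreover have "Min (dist x ` A m) \<in> dist x ` A m"
    using assms by (intro Min_in) auto
  ultimately show ?thesis
    by (auto simp: nearest_def)
qed

text \<open>A finite nonempty set attains its diameter, so the bound stays strict, as
  \<open>hyp_points\<close> demands; \<open>0 < d\<close> covers the empty set.\<close>

lemma finite_diameter_less:
  assumes "finite S" "0 < d" "\<And>x y. x \<in> S \<Longrightarrow> y \<in> S \<Longrightarrow> dist x y < d"
  shows "diameter S < d"
proof (cases "S = {}")
  case False
  then obtain x y where "x \<in> S" "y \<in> S" "dist x y = diameter S"
    using diameter_compact_attained[OF finite_imp_compact[OF assms(1)]] by auto
  with assms(3) show ?thesis
    by metis
qed (use assms(2) in simp)

section \<open>The scales of a FASO\<close>

locale faso =
  fixes X :: "'a::metric_space set" and \<epsilon> :: "nat \<Rightarrow> real" and A :: "nat \<Rightarrow> 'a set"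
  assumes compact: "compact X" and nonempty: "X \<noteq> {}" and FASO: "FASO X \<epsilon> A"
begin

abbreviation \<gamma> :: "nat \<Rightarrow> real"
  where "\<gamma> \<equiv> covering_defect X A"

lemma
  assumes "n \<ge> 1"
  shows eps_pos: "0 < \<epsilon> n"
    and finite_A: "finite (A n)"
    and A_subset: "A n \<subseteq> X"
    and A_near: "x \<in> X \<Longrightarrow> \<exists>a\<in>A n. dist x a < \<epsilon> n"
    and eps_Suc: "2 * \<epsilon> (Suc n) + \<gamma> n < \<epsilon> n"
  using FASO assms by (auto simp: FASO_def eps_approximation_def field_simps)

lemma A_nonempty: "n \<ge> 1 \<Longrightarrow> A n \<noteq> {}"
  using A_near nonempty by blast

lemma infdist_le_defect:
  assumes "n \<ge> 1" "x \<in> X"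
  shows "infdist x (A n) \<le> \<gamma> n"
  unfolding covering_defect_def
proof (rule cSUP_upper[OF assms(2)])
  \<comment> \<open>A real supremum bounds its members only if the family is bounded; here
    \<open>\<epsilon> n\<close> is a bound, by the approximation property.\<close>
  show "bdd_above ((\<lambda>x. infdist x (A n)) ` X)"
    using A_near[OF assms(1)] by (intro bdd_aboveI2[where M = "\<epsilon> n"]) (meson infdist_le2 less_imp_le)
qed

lemma defect_nonneg: "n \<ge> 1 \<Longrightarrow> 0 \<le> \<gamma> n"
  using infdist_le_defect nonempty infdist_nonneg order_trans by (metis ex_in_conv)

lemma nearest_dist: "n \<ge> 1 \<Longrightarrow> x \<in> X \<Longrightarrow> a \<in> nearest A n x \<Longrightarrow> dist x a \<le> \<gamma> n"
  using infdist_le_defect by (auto simp: nearest_def)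

text \<open>As \<gamma> is nonnegative, the FASO inequality more than halves the scale at each step.
  Counting starts at 1 because \<open>\<epsilon> 0\<close> is unconstrained.\<close>

lemma eps_le_power: "\<epsilon> (Suc n) \<le> \<epsilon> 1 * (1 / 2) ^ n"
proof (induction n)
  case (Suc n)
  then show ?case
    using eps_Suc[of "Suc n"] defect_nonneg[of "Suc n"] by simp
qed simp

lemma eps_tendsto_0: "\<epsilon> \<longlonglongrightarrow> 0"
proof (rule LIMSEQ_imp_Suc, rule tendsto_sandwich[where f = "\<lambda>n. 0"])
  show "(\<lambda>n. \<epsilon> 1 * (1 / 2) ^ n) \<longlonglongrightarrow> 0"
    by (intro tendsto_mult_right_zero LIMSEQ_power_zero) simp
qed (use eps_le_power eps_pos in \<open>auto intro!: always_eventually less_imp_le\<close>)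

lemma eps_small:
  assumes "0 < e"
  shows "\<exists>n\<ge>1. \<epsilon> n < e"
  using eventually_conj[OF order_tendstoD(2)[OF eps_tendsto_0 assms] eventually_ge_at_top[of 1]]
  by (auto dest!: eventually_happens)

section \<open>The sets of nearest points and the thread they generate\<close>

lemma nearest_subset_bond:
  assumes "n \<ge> 1" "x \<in> X" "y \<in> X" and "dist x y + 2 * \<epsilon> (Suc n) + \<gamma> n < \<epsilon> n"
  shows "nearest A n x \<subseteq> bond \<epsilon> A n (nearest A (Suc n) y)"
proof
  fix a assume a: "a \<in> nearest A n x"
  obtain b where b: "b \<in> nearest A (Suc n) y"
    using nearest_nonempty[of A "Suc n" y] finite_A[of "Suc n"] A_nonempty[of "Suc n"] by auto
  have "\<gamma> (Suc n) < \<epsilon> (Suc n)"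
    using eps_Suc[of "Suc n"] eps_pos[of "Suc (Suc n)"] by simp
  \<comment> \<open>The summands are at most \<open>\<gamma> n\<close>, \<open>dist x y\<close> and
    \<open>\<gamma> (Suc n) < \<epsilon> (Suc n)\<close>. The case \<open>y = x\<close> makes the
    stages of \<open>star_set\<close> increase; \<open>y\<close> near \<open>x\<close> gives their
    stability.\<close>
  moreover have "dist b a \<le> dist x a + dist x y + dist y b"
    using dist_triangle[of b a x] dist_triangle[of b x y] by (simp add: dist_commute)
  ultimately have "dist b a < \<epsilon> n"
    using nearest_dist[OF assms(1,2) a] nearest_dist[OF _ assms(3) b] assms(4) eps_pos[of "Suc n"]
    by simp
  then show "a \<in> bond \<epsilon> A n (nearest A (Suc n) y)"
    using a b by (auto simp: bond_def nearest_def)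
qed

lemma bonds_nearest_step:
  assumes "n \<ge> 1" "n \<le> m" "x \<in> X"
  shows "bonds \<epsilon> A n m (nearest A m x) \<subseteq> bonds \<epsilon> A n (Suc m) (nearest A (Suc m) x)"
  using assms eps_Suc[of m]
  by (simp add: bonds_Suc_right) (intro bonds_mono nearest_subset_bond, auto)

lemma bonds_nearest_mono:
  assumes "n \<ge> 1" "n \<le> m" "m \<le> k" "x \<in> X"
  shows "bonds \<epsilon> A n m (nearest A m x) \<subseteq> bonds \<epsilon> A n k (nearest A k x)"
  using assms(3)
proof (induction k rule: dec_induct)
  case (step k)
  then show ?case
    using bonds_nearest_step[of n k x] assms by auto
qed simp

text \<open>Downward induction from \<open>\<gamma> m < \<epsilon> m\<close>: a bonding map adds
  less than \<open>\<epsilon> n\<close> to the radius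
  \<open>2 * \<epsilon> (Suc n) < \<epsilon> n\<close>, so the sum stays below
  \<open>2 * \<epsilon> n\<close>.\<close>

lemma bonds_nearest_bound:
  assumes "n \<ge> 1" "n \<le> m" "x \<in> X" "a \<in> bonds \<epsilon> A n m (nearest A m x)"
  shows "a \<in> A n \<and> dist x a < 2 * \<epsilon> n"
  using assms(2,1,4)
proof (induction n arbitrary: a rule: inc_induct)
  case base
  have "0 < \<epsilon> m" "\<gamma> m < \<epsilon> m"
    using base eps_Suc[of m] eps_pos[of "Suc m"] eps_pos[of m] by auto
  then show ?case
    using base nearest_dist[of m x a] assms(3) by (auto simp: nearest_def)
next
  case (step n)
  then obtain b where b: "b \<in> bonds \<epsilon> A (Suc n) m (nearest A m x)" "dist b a < \<epsilon> n" "a \<in> A n"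
    by (auto simp: bonds_Suc_left bond_def)
  have "dist x a \<le> dist x b + dist b a"
    by (rule dist_triangle)
  moreover have "dist x b < 2 * \<epsilon> (Suc n)"
    using step.IH b by auto
  ultimately show ?case
    using b eps_Suc[of n] defect_nonneg[of n] step.prems by auto
qed

lemma star_set_bound:
  assumes "n \<ge> 1" "x \<in> X" "a \<in> star_set \<epsilon> A x n"
  shows "a \<in> A n \<and> dist x a < 2 * \<epsilon> n"
proof -
  obtain m where "n < m" "a \<in> bonds \<epsilon> A n m (nearest A m x)"
    using assms(3) by (auto simp: star_set_def)
  then show ?thesis
    using bonds_nearest_bound[of n m x a] assms(1,2) by simp
qed

text \<open>The stages form a chain of subsets of the finite set \<open>A n\<close>, so their union
  is one of them. Perturbing \<open>x\<close> then has to be controlled at a single stage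
  \<open>m\<close> only.\<close>

lemma star_set_stable:
  assumes "n \<ge> 1" "x \<in> X"
  shows "\<exists>m>n. star_set \<epsilon> A x n = bonds \<epsilon> A n m (nearest A m x)"
proof -
  let ?F = "\<lambda>m. bonds \<epsilon> A n m (nearest A m x)"
  have "?F m \<subseteq> A n" if "n < m" for m
    using bonds_nearest_bound[OF assms(1) _ assms(2), of m] that by auto
  then have "?F ` {n<..} \<subseteq> Pow (A n)"
    by auto
  then have "finite (?F ` {n<..})"
    using finite_A[OF assms(1)] finite_subset by blast
  moreover have "?F ` {n<..} \<noteq> {}"
    by auto
  moreover have "\<Union>\<C> \<in> \<C>" if "finite \<C>" "\<C> \<noteq> {}" "\<And>B C. B \<in> \<C> \<Longrightarrow> C \<in> \<C> \<Longrightarrow> B \<subseteq> C \<or> C \<subseteq> B"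
    for \<C> :: "'a set set"
    using that by (intro Union_in_chain) (auto simp: subset_chain_def)
  moreover have "?F i \<subseteq> ?F j \<or> ?F j \<subseteq> ?F i" if "i > n" "j > n" for i j
    using bonds_nearest_mono[OF assms(1) _ _ assms(2)] that by (meson less_imp_le linear)
  ultimately have "\<Union>(?F ` {n<..}) \<in> ?F ` {n<..}"
    by blast
  then show ?thesis
    by (auto simp: star_set_def)
qed

lemma star_set_mono_near:
  assumes "n \<ge> 1" "x \<in> X"
  shows "\<exists>e>0. \<forall>y\<in>X. dist x y < e \<longrightarrow> star_set \<epsilon> A x n \<subseteq> star_set \<epsilon> A y n"
proof -
  obtain m where m: "m > n" "star_set \<epsilon> A x n = bonds \<epsilon> A n m (nearest A m x)"
    using star_set_stable[OF assms] by blast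
  \<comment> \<open>The radius is the slack in the FASO inequality at the stage \<open>m\<close>
    where the union has stabilised; it is the hypothesis of \<open>nearest_subset_bond\<close>
    solved for \<open>dist x y\<close>.\<close>
  have "star_set \<epsilon> A x n \<subseteq> star_set \<epsilon> A y n"
    if y: "y \<in> X" "dist x y < \<epsilon> m - \<gamma> m - 2 * \<epsilon> (Suc m)" for y
  proof -
    have "star_set \<epsilon> A x n \<subseteq> bonds \<epsilon> A n (Suc m) (nearest A (Suc m) y)"
      using m assms y by (simp add: bonds_Suc_right) (intro bonds_mono nearest_subset_bond, auto)
    also have "\<dots> \<subseteq> star_set \<epsilon> A y n"
      using m(1) by (force simp: star_set_def)
    finally show ?thesis .
  qed
  moreover have "0 < \<epsilon> m - \<gamma> m - 2 * \<epsilon> (Suc m)"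
    using eps_Suc[of m] m assms by simp
  ultimately show ?thesis
    by blast
qed

text \<open>Bonding maps commute with unions, so the two sides differ only in the stage
  \<open>m = Suc n\<close>, which is absorbed by the next one.\<close>

lemma bond_star_set:
  assumes "n \<ge> 1" "x \<in> X"
  shows "bond \<epsilon> A n (star_set \<epsilon> A x (Suc n)) = star_set \<epsilon> A x n"
proof -
  have "bond \<epsilon> A n (star_set \<epsilon> A x (Suc n))
      = (\<Union>m\<in>{Suc n<..}. bonds \<epsilon> A n m (nearest A m x))"
    unfolding star_set_def bond_UN by (intro SUP_cong) (auto simp: bonds_Suc_left)
  also have "\<dots> = (\<Union>m\<in>{n<..}. bonds \<epsilon> A n m (nearest A m x))"
  proof (intro subset_antisym SUP_mono)
    show "\<exists>k\<in>{Suc n<..}. bonds \<epsilon> A n m (nearest A m x) \<subseteq> bonds \<epsilon> A n k (nearest A k x)"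
      if "m \<in> {n<..}" for m
      using bonds_nearest_step[OF assms(1) _ assms(2), of m] that
      by (intro bexI[of _ "Suc m"]) auto
  qed auto
  finally show ?thesis
    by (simp add: star_set_def)
qed

lemma star_set_nonempty:
  assumes "n \<ge> 1" "x \<in> X"
  shows "star_set \<epsilon> A x n \<noteq> {}"
proof -
  have "nearest A n x \<noteq> {}"
    using assms finite_A A_nonempty by (intro nearest_nonempty) auto
  \<comment> \<open>The union defining \<open>star_set\<close> starts above \<open>n\<close>, so the
    nearest points at level \<open>n\<close> enter through stage \<open>Suc n\<close>.\<close>
  moreover have "nearest A n x \<subseteq> bonds \<epsilon> A n (Suc n) (nearest A (Suc n) x)"
    using bonds_nearest_step[of n n x] assms by simp
  ultimately show ?thesis
    by (auto simp: star_set_def)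
qed

lemma phi_in_inv_limit:
  assumes "x \<in> X"
  shows "phi \<epsilon> A x \<in> topspace (inv_limit \<epsilon> A)"
proof -
  have "star_set \<epsilon> A x n \<in> hyp_points (4 * \<epsilon> n) (A n)" if n: "n \<ge> 1" for n
  proof -
    note bound = star_set_bound[OF n assms]
    have "diameter (star_set \<epsilon> A x n) < 4 * \<epsilon> n"
    proof (rule finite_diameter_less)
      show "finite (star_set \<epsilon> A x n)"
        using bound finite_A[OF n] by (meson finite_subset subsetI)
      show "dist a b < 4 * \<epsilon> n" if "a \<in> star_set \<epsilon> A x n" "b \<in> star_set \<epsilon> A x n" for a b
        using bound[OF that(1)] bound[OF that(2)] dist_triangle3[of a b x] by linarith
    qed (use eps_pos[OF n] in simp)
    then show ?thesis
      using bound star_set_nonempty[OF n assms] by (auto simp: hyp_points_def)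
  qed
  then show ?thesis
    using assms bond_star_set by (auto simp: topspace_inv_limit phi_def)
qed

section \<open>The limit point of a thread\<close>

definition limit_point :: "(nat \<Rightarrow> 'a set) \<Rightarrow> 'a \<Rightarrow> bool"
  where "limit_point C x \<longleftrightarrow> x \<in> X \<and> (\<forall>n\<ge>1. \<forall>a\<in>C n. dist x a \<le> 2 * \<epsilon> n)"

lemma limit_point_phi: "x \<in> X \<Longrightarrow> limit_point (phi \<epsilon> A x) x"
  using star_set_bound[of _ x] by (auto simp: limit_point_def phi_def less_imp_le)

text \<open>Both points are within \<open>2 * \<epsilon> n\<close> of a common element of
  \<open>C n\<close>. With \<open>C = D\<close> this yields uniqueness, with \<open>D\<close> in a
  neighbourhood of \<open>C\<close> the continuity of the limit.\<close>

lemma limit_points_dist: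
  assumes "limit_point C x" "limit_point D y" "n \<ge> 1" "C n \<noteq> {}" "C n \<subseteq> D n"
  shows "dist x y \<le> 4 * \<epsilon> n"
proof -
  obtain a where "a \<in> C n"
    using assms(4) by blast
  then have "dist x a \<le> 2 * \<epsilon> n" "dist y a \<le> 2 * \<epsilon> n"
    using assms by (auto simp: limit_point_def)
  then show ?thesis
    using dist_triangle2[of x y a] by linarith
qed

lemma thread_nonempty: "C \<in> topspace (inv_limit \<epsilon> A) \<Longrightarrow> n \<ge> 1 \<Longrightarrow> C n \<noteq> {}"
  by (simp add: topspace_inv_limit hyp_points_def)

lemma limit_point_unique:
  assumes "C \<in> topspace (inv_limit \<epsilon> A)" "limit_point C x" "limit_point C y"
  shows "x = y"
proof (rule ccontr)
  assume "x \<noteq> y"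
  then obtain n where "n \<ge> 1" "\<epsilon> n < dist x y / 4"
    using eps_small[of "dist x y / 4"] by auto
  then show False
    using limit_points_dist[OF assms(2,3)] thread_nonempty[OF assms(1)] by fastforce
qed

text \<open>Every element of a level is less than \<epsilon> away from some element of the next. The
  total telescopes, since
  \<open>\<epsilon> m < 2 * \<epsilon> m - 2 * \<epsilon> (Suc m)\<close>.\<close>

lemma thread_step_dist:
  assumes C: "C \<in> topspace (inv_limit \<epsilon> A)" and "n \<ge> 1" "n \<le> m" "a \<in> C n"
  shows "\<exists>b\<in>C m. dist a b \<le> 2 * \<epsilon> n - 2 * \<epsilon> m"
  using assms(3)
proof (induction m rule: dec_induct)
  case base
  then show ?case
    using assms(4) by (auto intro!: bexI[of _ a])
next
  case (step m)
  then obtain b where b: "b \<in> C m" "dist a b \<le> 2 * \<epsilon> n - 2 * \<epsilon> m"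
    by blast
  moreover have "bond \<epsilon> A m (C (Suc m)) = C m"
    using C step assms(2) by (simp add: topspace_inv_limit)
  ultimately have "b \<in> bond \<epsilon> A m (C (Suc m))"
    by simp
  then obtain c where c: "c \<in> C (Suc m)" "dist c b < \<epsilon> m"
    by (auto simp: bond_def)
  have "dist a c \<le> dist a b + dist c b"
    by (rule dist_triangle2)
  then have "dist a c \<le> 2 * \<epsilon> n - 2 * \<epsilon> (Suc m)"
    using b c eps_Suc[of m] defect_nonneg[of m] step assms(2) by simp
  then show ?case
    using c by blast
qed

text \<open>Passing from the element reached by \<open>thread_step_dist\<close> to an arbitrary
  \<open>b\<close> costs at most the diameter bound \<open>4 * \<epsilon> m\<close>.\<close>

lemma thread_dist:
  assumes C: "C \<in> topspace (inv_limit \<epsilon> A)" and "n \<ge> 1" "n \<le> m" "a \<in> C n" "b \<in> C m"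
  shows "dist a b \<le> 2 * \<epsilon> n + 2 * \<epsilon> m"
proof -
  obtain c where c: "c \<in> C m" "dist a c \<le> 2 * \<epsilon> n - 2 * \<epsilon> m"
    using thread_step_dist[OF assms(1-4)] by blast
  have "C m \<subseteq> A m" "diameter (C m) < 4 * \<epsilon> m"
    using C assms(2,3) by (auto simp: topspace_inv_limit hyp_points_def)
  moreover have "bounded (C m)"
    using calculation(1) finite_A[of m] assms(2,3) by (auto intro: finite_imp_bounded finite_subset)
  ultimately have "dist c b \<le> 4 * \<epsilon> m"
    using diameter_bounded_bound[OF _ c(1) assms(5)] by simp
  then show ?thesis
    using c dist_triangle[of a b c] by simp
qed

text \<open>Compactness gives a cluster point of any selection \<open>c n\<close> from
  \<open>C n\<close>, and \<open>thread_dist\<close> passes to the limit. The selection is shifted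
  by \<open>Suc\<close> because \<open>C 0\<close> carries no information.\<close>

lemma limit_point_exists:
  assumes C: "C \<in> topspace (inv_limit \<epsilon> A)"
  shows "\<exists>x. limit_point C x"
proof -
  have "\<forall>n\<in>{1..}. \<exists>a. a \<in> C n"
    using thread_nonempty[OF C] by auto
  then obtain c where c: "\<And>n. n \<ge> 1 \<Longrightarrow> c n \<in> C n"
    by (metis atLeast_iff)
  have "\<forall>n. c (Suc n) \<in> X"
  proof
    fix n
    have "C (Suc n) \<subseteq> A (Suc n)"
      using C by (simp add: topspace_inv_limit hyp_points_def)
    then show "c (Suc n) \<in> X"
      using c[of "Suc n"] A_subset[of "Suc n"] by auto
  qed
  then obtain x r where x: "x \<in> X" "strict_mono r" "(\<lambda>n. c (Suc (r n))) \<longlonglongrightarrow> x"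
    using compact[unfolded compact_def, rule_format, of "\<lambda>n. c (Suc n)"] by (auto simp: comp_def)
  have eps0: "(\<lambda>n. \<epsilon> (Suc (r n))) \<longlonglongrightarrow> 0"
    using LIMSEQ_subseq_LIMSEQ[OF LIMSEQ_Suc[OF eps_tendsto_0] x(2)] by (simp add: comp_def)
  have "dist x a \<le> 2 * \<epsilon> n" if n: "n \<ge> 1" and a: "a \<in> C n" for n a
  \<comment> \<open>Limits preserve only non-strict inequalities, hence the \<le> in
    \<open>limit_point\<close>.\<close>
  proof (rule tendsto_le[OF sequentially_bot])
    show "(\<lambda>k. dist (c (Suc (r k))) a) \<longlonglongrightarrow> dist x a"
      by (intro tendsto_intros x)
    show "(\<lambda>k. 2 * \<epsilon> n + 2 * \<epsilon> (Suc (r k))) \<longlonglongrightarrow> 2 * \<epsilon> n"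
      using tendsto_add[OF tendsto_const tendsto_mult_right_zero[OF eps0]] by force
    have "dist (c (Suc (r k))) a \<le> 2 * \<epsilon> n + 2 * \<epsilon> (Suc (r k))" if "k \<ge> n" for k
      using thread_dist[OF C n _ a c, of "Suc (r k)"] seq_suble[OF x(2), of k] that
      by (simp add: dist_commute)
    then show "\<forall>\<^sub>F k in sequentially. dist (c (Suc (r k))) a \<le> 2 * \<epsilon> n + 2 * \<epsilon> (Suc (r k))"
      by (rule eventually_sequentiallyI)
  qed
  then show ?thesis
    using x(1) by (auto simp: limit_point_def)
qed

definition lim_of :: "(nat \<Rightarrow> 'a set) \<Rightarrow> 'a"
  where "lim_of C = (THE x. limit_point C x)"

lemma lim_of: "C \<in> topspace (inv_limit \<epsilon> A) \<Longrightarrow> limit_point C (lim_of C)"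
  unfolding lim_of_def using limit_point_exists limit_point_unique by (metis theI')

lemma lim_of_in_X: "C \<in> topspace (inv_limit \<epsilon> A) \<Longrightarrow> lim_of C \<in> X"
  using lim_of by (simp add: limit_point_def)

lemma lim_of_phi: "x \<in> X \<Longrightarrow> lim_of (phi \<epsilon> A x) = x"
  using limit_point_unique lim_of limit_point_phi phi_in_inv_limit by blast

section \<open>Minimality of \<open>phi \<epsilon> A x\<close> among the threads with limit point
  \<open>x\<close>\<close>

lemma nearest_subset_thread:
  assumes C: "C \<in> topspace (inv_limit \<epsilon> A)" and x: "limit_point C x" and "n \<ge> 1"
  shows "nearest A n x \<subseteq> C n"
proof
  fix a assume a: "a \<in> nearest A n x"
  \<comment> \<open>A single \<open>c\<close> suffices: all nearest points of \<open>x\<close> in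
    \<open>A n\<close> lie in its ball of radius \<open>\<epsilon> n\<close>, hence in the image of
    \<open>C (Suc n)\<close>, which is \<open>C n\<close>.\<close>
  obtain c where c: "c \<in> C (Suc n)"
    using thread_nonempty[OF C, of "Suc n"] by auto
  have "dist x c \<le> 2 * \<epsilon> (Suc n)" "dist x a \<le> \<gamma> n"
    using c x a nearest_dist[OF assms(3)] by (auto simp: limit_point_def)
  then have "dist c a < \<epsilon> n"
    using dist_triangle3[of c a x] eps_Suc[OF assms(3)] by simp
  then have "a \<in> bond \<epsilon> A n (C (Suc n))"
    using a c by (auto simp: bond_def nearest_def)
  then show "a \<in> C n"
    using C assms(3) by (simp add: topspace_inv_limit)
qed

lemma bonds_thread:
  assumes "C \<in> topspace (inv_limit \<epsilon> A)" "n \<ge> 1" "n \<le> m"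
  shows "bonds \<epsilon> A n m (C m) = C n"
  using assms(3,2)
  by (induction n rule: inc_induct) (use assms(1) in \<open>auto simp: bonds_Suc_left topspace_inv_limit\<close>)

text \<open>Each stage is the image of nearest points lying in \<open>C m\<close>, and the bonding
  maps carry \<open>C m\<close> to \<open>C n\<close>.\<close>

lemma star_set_subset_thread:
  assumes "C \<in> topspace (inv_limit \<epsilon> A)" "limit_point C x" "n \<ge> 1"
  shows "star_set \<epsilon> A x n \<subseteq> C n"
  unfolding star_set_def
proof (rule UN_least)
  fix m assume m: "m \<in> {n<..}"
  then have "bonds \<epsilon> A n m (nearest A m x) \<subseteq> bonds \<epsilon> A n m (C m)"
    using assms by (intro bonds_mono nearest_subset_thread) auto
  also have "\<dots> = C n"
    using m assms by (intro bonds_thread) auto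
  finally show "bonds \<epsilon> A n m (nearest A m x) \<subseteq> C n" .
qed

section \<open>The homotopy and its continuity\<close>

lemma star_set_lim_of_mono_near:
  assumes C: "C \<in> topspace (inv_limit \<epsilon> A)" and n: "n \<ge> 1"
  shows "\<exists>U. openin (inv_limit \<epsilon> A) U \<and> C \<in> U \<and>
    (\<forall>D\<in>U. star_set \<epsilon> A (lim_of C) n \<subseteq> star_set \<epsilon> A (lim_of D) n)"
proof -
  obtain e where e: "e > 0" "\<And>y. y \<in> X \<Longrightarrow> dist (lim_of C) y < e \<Longrightarrow>
      star_set \<epsilon> A (lim_of C) n \<subseteq> star_set \<epsilon> A y n"
    using star_set_mono_near[OF n lim_of_in_X[OF C]] by blast
  \<comment> \<open>Threads \<open>D\<close> with \<open>C m \<subseteq> D m\<close> have limits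
    within \<open>4 * \<epsilon> m\<close> of that of \<open>C\<close>, hence the quarter of
    \<open>e\<close>.\<close>
  obtain m where m: "m \<ge> 1" "\<epsilon> m < e / 4"
    using eps_small[of "e / 4"] e(1) by auto
  let ?U = "{D \<in> topspace (inv_limit \<epsilon> A). C m \<subseteq> D m}"
  have "star_set \<epsilon> A (lim_of C) n \<subseteq> star_set \<epsilon> A (lim_of D) n" if D: "D \<in> ?U" for D
  proof (rule e(2))
    show "lim_of D \<in> X"
      using D lim_of_in_X by blast
    have "dist (lim_of C) (lim_of D) \<le> 4 * \<epsilon> m"
      using D m thread_nonempty[OF C] limit_points_dist[OF lim_of[OF C] lim_of[of D]] by auto
    then show "dist (lim_of C) (lim_of D) < e"
      using m by simp
  qed
  then show ?thesis
    using openin_inv_limit_supersets[OF m(1)] C by (intro exI[of _ ?U]) auto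
qed

definition retraction_homotopy :: "(nat \<Rightarrow> 'a set) \<times> real \<Rightarrow> nat \<Rightarrow> 'a set"
  where "retraction_homotopy = (\<lambda>(C, t). if t < 1 then C else phi \<epsilon> A (lim_of C))"

lemma retraction_homotopy_in_inv_limit:
  "C \<in> topspace (inv_limit \<epsilon> A) \<Longrightarrow> retraction_homotopy (C, t) \<in> topspace (inv_limit \<epsilon> A)"
  by (simp add: retraction_homotopy_def phi_in_inv_limit lim_of_in_X)

text \<open>A lower bound uniform in \<open>t\<close>: at time 1 it lets one neighbourhood serve all
  times.\<close>

lemma star_set_subset_retraction_homotopy:
  "C \<in> topspace (inv_limit \<epsilon> A) \<Longrightarrow> n \<ge> 1 \<Longrightarrow>
    star_set \<epsilon> A (lim_of C) n \<subseteq> retraction_homotopy (C, t) n"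
  using star_set_subset_thread[OF _ lim_of] by (auto simp: retraction_homotopy_def phi_def)

lemma continuous_map_retraction_homotopy:
  "continuous_map (prod_topology (inv_limit \<epsilon> A) (top_of_set {0..1})) (inv_limit \<epsilon> A)
    retraction_homotopy"
proof -
  let ?T = "inv_limit \<epsilon> A" and ?I = "top_of_set {0..1::real}"
  have "continuous_map (prod_topology ?T ?I) (hyp_topology (4 * \<epsilon> n) (A n))
      (\<lambda>p. retraction_homotopy p n)" if n: "n \<ge> 1" for n
  proof (rule continuous_map_hyp_topologyI; safe?)
    fix C t assume "(C, t) \<in> topspace (prod_topology ?T ?I)"
    then have C: "C \<in> topspace ?T" and t: "t \<in> {0..1}"
      by auto
    show "retraction_homotopy (C, t) n \<in> hyp_points (4 * \<epsilon> n) (A n)"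
      using retraction_homotopy_in_inv_limit[OF C] n by (simp add: topspace_inv_limit)
    show "\<exists>U. openin (prod_topology ?T ?I) U \<and> (C, t) \<in> U \<and>
        (\<forall>p\<in>U. retraction_homotopy (C, t) n \<subseteq> retraction_homotopy p n)"
    proof (cases "t < 1")
      case True
      \<comment> \<open>Away from time 1 the homotopy does not move threads, so it is enough to keep
        term \<open>n\<close> from shrinking.\<close>
      let ?U = "{D \<in> topspace ?T. C n \<subseteq> D n} \<times> {0..<1}"
      have "openin ?I ({0..1} \<inter> {..<1})"
        by (intro openin_open_Int) simp
      then have "openin ?I {0..<1}"
        by (rule back_subst[of "openin ?I"]) auto
      then have "openin (prod_topology ?T ?I) ?U"
        unfolding openin_prod_Times_iff using openin_inv_limit_supersets[OF n] by blast
      then show ?thesis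
        using C t True by (intro exI[of _ ?U]) (auto simp: retraction_homotopy_def)
    next
      case False
      obtain U where U: "openin ?T U" "C \<in> U"
        "\<And>D. D \<in> U \<Longrightarrow> star_set \<epsilon> A (lim_of C) n \<subseteq> star_set \<epsilon> A (lim_of D) n"
        using star_set_lim_of_mono_near[OF C n] by blast
      \<comment> \<open>Here \<open>t = 1\<close>, and earlier times must be included. Their value
        \<open>D n\<close> contains the star set of the limit of \<open>D\<close>, which contains
        that of the limit of \<open>C\<close>.\<close>
      have "openin (prod_topology ?T ?I) (U \<times> {0..1})"
        using U(1) openin_topspace[of ?I] by (simp add: openin_prod_Times_iff)
      moreover have "retraction_homotopy (C, t) n \<subseteq> retraction_homotopy (D, s) n" if "D \<in> U" for D s
      proof -
        have "retraction_homotopy (C, t) n = star_set \<epsilon> A (lim_of C) n"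
          using False n by (simp add: retraction_homotopy_def phi_def)
        also have "\<dots> \<subseteq> star_set \<epsilon> A (lim_of D) n"
          using U(3) that .
        also have "\<dots> \<subseteq> retraction_homotopy (D, s) n"
          using that openin_subset[OF U(1)] n by (intro star_set_subset_retraction_homotopy) auto
        finally show ?thesis .
      qed
      ultimately show ?thesis
        using U(2) t by (intro exI[of _ "U \<times> {0..1}"]) auto
    qed
  qed
  moreover have "retraction_homotopy ` topspace (prod_topology ?T ?I) \<subseteq> topspace ?T"
    using retraction_homotopy_in_inv_limit by auto
  ultimately show ?thesis
    by (intro continuous_map_into_inv_limit) auto
qed

text \<open>Threads in the image of \<open>phi\<close> stay fixed even at time 1, because
  \<open>lim_of\<close> recovers \<open>x\<close> from \<open>phi \<epsilon> A x\<close>.\<close>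

lemma strong_deformation_retract_phi:
  "strong_deformation_retract_of_space (phi \<epsilon> A ` X) (inv_limit \<epsilon> A)"
  unfolding strong_deformation_retract_of_space_def
  using phi_in_inv_limit lim_of_in_X continuous_map_retraction_homotopy
  by (intro conjI exI[of _ retraction_homotopy]) (auto simp: retraction_homotopy_def lim_of_phi)

end

theorem theorem3p15:
  fixes X :: "'a::metric_space set"
    and \<epsilon> :: "nat \<Rightarrow> real"
    and A :: "nat \<Rightarrow> 'a set"
  assumes "compact X" and "X \<noteq> {}"
    and "FASO X \<epsilon> A"
  shows "strong_deformation_retract_of_space (phi \<epsilon> A ` X) (inv_limit \<epsilon> A)"
proof -
  interpret faso X \<epsilon> A
    using assms by unfold_locales
  show ?thesis
    by (rule strong_deformation_retract_phi)
qed

end
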